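(* Let $(K,v)$ be a valued field with infinite value group. For arbitrarily large integers $n$, there are finite sets $P\subseteq K^2$ and $Q\subseteq K^4$ with $|P|+|Q|=n$ such that the bipartite graph on $P$ and $Q$ whose edge relation is the point–box incidence relation $I_2(x;u,w)$ (with $x\in P$, $(u,w)\in Q$) is $K_{2,2}$-free and has $$\Omega\!\left(n\,\frac{\log n}{\log\log n}\right)$$ edges. The edge relation $I_2$ is semilinear of description complexity $(1,4)$.
   Context: For $x,u,w\in K^d$, the point–box incidence relation is $$I_d(x;u,w):=\bigwedge_{j=1}^{d}\bigl(v(u_j)<v(x_j)\ \wedge\ v(x_j)<v(w_j)\bigr).$$ For $u,w\in(K^\times)^d$ with $v(u_j)<v(w_j)$ for all $j$, it expresses that $x$ lies in the open valuative box $\mathcal B(u,w)=\{x\in K^d:v(u_j)<v(x_j)<v(w_j)\text{ for every }j\}$; parameters in $Q$ are pairs $(u,w)\in(K^\times)^2\times(K^\times)^2$ of this kind. The value group is $v(K^\times)$, and $v(0)=\infty$. A set $X\subseteq K^d$ is semilinear of description complexity $(\rho,s)$ if it is a union of at most $\rho$ sets, each defined by a conjunction of at most $s$ conditions $v(f_j(x))\ \square_j\ v(g_j(x))$ with $\square_j\in\{<,\le,>,\ge\}$ and $f_j,g_j:K^d\to K$ affine $K$-linear. A bipartite graph is $K_{2,2}$-free if no two distinct vertices of one side are both adjacent to two distinct vertices of the other. *)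

theory Defs
  imports "HOL-Analysis.Analysis" "HOL-Library.Extended"
begin

text \<open>
  A (Krull) valuation on a field, written additively. Its values lie in an ordered abelian group
  extended by \<open>\<infinity>\<close>, which is \<^const>\<open>Pinf\<close> here; the type \<open>'g extended\<close> has an additional
  bottom element \<^const>\<open>Minf\<close>, which is never a value. The valuation need not be onto \<open>'g\<close>:
  the value group is its image on the nonzero elements.
\<close>

locale valued_field =
  fixes v :: "'k::field \<Rightarrow> 'g::linordered_ab_group_add extended"
  assumes v_not_Minf: "v x \<noteq> Minf"
    and v_eq_Pinf_iff: "v x = Pinf \<longleftrightarrow> x = 0"
    and v_mult: "v (x * y) = v x + v y"
    and v_add: "v (x + y) \<ge> min (v x) (v y)"

definition value_group :: "('k::field \<Rightarrow> 'g::linordered_ab_group_add extended) \<Rightarrow> 'g extended set"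
  where "value_group v = v ` {x. x \<noteq> 0}"

definition box_incidence ::
    "('k::field \<Rightarrow> 'g::linordered_ab_group_add extended) \<Rightarrow> 'k^'d \<Rightarrow> 'k^'d \<Rightarrow> 'k^'d \<Rightarrow> bool"
  where "box_incidence v x u w \<longleftrightarrow> (\<forall>j. v (u $ j) < v (x $ j) \<and> v (x $ j) < v (w $ j))"

definition box_parameters ::
    "('k::field \<Rightarrow> 'g::linordered_ab_group_add extended) \<Rightarrow> (('k^'d) \<times> ('k^'d)) set"
  where "box_parameters v =
    {(u, w). \<forall>j. u $ j \<noteq> 0 \<and> w $ j \<noteq> 0 \<and> v (u $ j) < v (w $ j)}"

definition affine_function :: "('k::field^'d \<Rightarrow> 'k) \<Rightarrow> bool"
  where "affine_function f \<longleftrightarrow>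
    (\<exists>l c. Vector_Spaces.linear (*s) (*) l \<and> (\<forall>x. f x = l x + c))"

definition valuative_condition ::
    "('k::field \<Rightarrow> 'g::linordered_ab_group_add extended) \<Rightarrow> ('k^'d) set \<Rightarrow> bool"
  where "valuative_condition v C \<longleftrightarrow>
    (\<exists>f g rel. affine_function f \<and> affine_function g \<and> rel \<in> {(<), (\<le>), (>), (\<ge>)} \<and>
       C = {x. rel (v (f x)) (v (g x))})"

definition valuative_conjunction ::
    "('k::field \<Rightarrow> 'g::linordered_ab_group_add extended) \<Rightarrow> nat \<Rightarrow> ('k^'d) set \<Rightarrow> bool"
  where "valuative_conjunction v s A \<longleftrightarrow>
    (\<exists>\<C>. finite \<C> \<and> card \<C> \<le> s \<and> (\<forall>C\<in>\<C>. valuative_condition v C) \<and> A = \<Inter>\<C>)"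

definition semilinear ::
    "('k::field \<Rightarrow> 'g::linordered_ab_group_add extended) \<Rightarrow> nat \<Rightarrow> nat \<Rightarrow> ('k^'d) set \<Rightarrow> bool"
  where "semilinear v \<rho> s X \<longleftrightarrow>
    (\<exists>\<A>. finite \<A> \<and> card \<A> \<le> \<rho> \<and> (\<forall>A\<in>\<A>. valuative_conjunction v s A) \<and> X = \<Union>\<A>)"

text \<open>
  Concatenation of coordinate vectors, identifying \<open>K\<^sup>m \<times> K\<^sup>n\<close> with \<open>K\<^sup>m\<^sup>+\<^sup>n\<close>;
  the coordinates of the result are indexed by the sum type.
\<close>

definition vec_append :: "'k^'m \<Rightarrow> 'k^'n \<Rightarrow> 'k^('m + 'n)"
  where "vec_append x y = (\<chi> i. case i of Inl a \<Rightarrow> x $ a | Inr b \<Rightarrow> y $ b)"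

text \<open>
  A bipartite graph is given by its set of edges between vertices of the two sides; the sides
  carry different types, so they are disjoint by construction.
\<close>

definition bipartite_edges :: "'a set \<Rightarrow> 'b set \<Rightarrow> ('a \<Rightarrow> 'b \<Rightarrow> bool) \<Rightarrow> ('a \<times> 'b) set"
  where "bipartite_edges P Q R = {(p, q). p \<in> P \<and> q \<in> Q \<and> R p q}"

definition K22_free :: "('a \<times> 'b) set \<Rightarrow> bool"
  where "K22_free E \<longleftrightarrow>
    \<not> (\<exists>p p' q q'. p \<noteq> p' \<and> q \<noteq> q' \<and> (p, q) \<in> E \<and> (p, q') \<in> E \<and> (p', q) \<in> E \<and> (p', q') \<in> E)"

end

theory Submission
  imports Defs
begin

text \<open>
  For a base \<open>b\<close>, identify the numbers \<open>p < b ^ k\<close> with the words of \<open>k\<close> digits. Place \<open>p\<close> in the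
  plane so that the first coordinate reads the word with its leading digits most significant and the
  second reads it with its trailing digits most significant, that is, at
  \<open>(p, digit_reversal b k p)\<close>. Fixing the digits above position \<open>i\<close> confines the first coordinate
  to an interval, and fixing the digits below position \<open>i\<close> confines the second coordinate to an
  interval. A combinatorial line, in which digit \<open>i\<close> is free and all the others are fixed, is thus
  cut out by a box (\<open>digit_point_in_line_box_iff\<close>). Two distinct words lie on a common line only if
  they differ in exactly one digit, and that digit and the remaining ones determine the line; so
  the incidence graph is \<open>K\<^sub>2\<^sub>,\<^sub>2\<close>-free (\<open>K22_free_digit_incidence\<close>). There are \<open>b ^ k\<close> points and
  \<open>k * b ^ (k - 1)\<close> lines, and each point lies on \<open>k\<close> lines. Taking \<open>b = k\<close>
  gives between \<open>k ^ k\<close> and \<open>2 * k ^ k\<close> vertices and at least \<open>k * k ^ k\<close> edges; since \<open>ln n\<close> is of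
  order \<open>k * ln k\<close> and \<open>ln (ln n)\<close> is at least \<open>ln k\<close>, the degree \<open>k\<close> is
  at least a constant times \<open>ln n / ln (ln n)\<close> (\<open>log_ratio_le\<close>).

  Only the order of the natural numbers enters this picture. An infinite value group is nontrivial,
  hence contains some \<open>v t > 0\<close>, and \<open>n \<mapsto> v (t ^ n)\<close> is then an order embedding of the natural
  numbers; replacing each grid coordinate \<open>n\<close> by \<open>t ^ n\<close> carries the whole configuration into
  \<open>K\<^sup>2\<close> (\<open>grid_incidence_realisation\<close>).

  That the relation is semilinear of complexity \<open>(1, 4)\<close> is read off from its definition: it is a
  conjunction of two strict comparisons of coordinate functions in each of the two dimensions.
\<close>

section \<open>Digit reversal\<close>

fun digit_reversal :: "nat \<Rightarrow> nat \<Rightarrow> nat \<Rightarrow> nat" where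
  "digit_reversal b 0 p = 0"
| "digit_reversal b (Suc k) p = (p mod b) * b ^ k + digit_reversal b k (p div b)"

lemma mult_add_eq_iff:
  fixes r r' M :: nat
  assumes "r < M" "r' < M"
  shows "d * M + r = d' * M + r' \<longleftrightarrow> d = d' \<and> r = r'"
proof
  assume eq: "d * M + r = d' * M + r'"
  have "(d * M + r) div M = d" "(d' * M + r') div M = d'"
    using assms by simp_all
  with eq show "d = d' \<and> r = r'" by simp
qed simp

lemma digit_reversal_less:
  assumes "b > 0"
  shows "digit_reversal b k p < b ^ k"
proof (induction k arbitrary: p)
  case (Suc k)
  have "p mod b < b" using assms by simp
  then have "Suc (p mod b) * b ^ k \<le> b * b ^ k" by (intro mult_right_mono) auto
  with Suc[of "p div b"] show ?case by simp
qed simp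

text \<open>The lowest \<open>i\<close> digits of \<open>p\<close> become the leading digits of its reversal.\<close>

lemma digit_reversal_add:
  "digit_reversal b (i + m) p = digit_reversal b i p * b ^ m + digit_reversal b m (p div b ^ i)"
  by (induction i arbitrary: p) (simp_all add: power_add div_mult2_eq algebra_simps)

lemma digit_reversal_eq_iff:
  assumes "b > 0"
  shows "digit_reversal b i p = digit_reversal b i q \<longleftrightarrow> p mod b ^ i = q mod b ^ i"
proof (induction i arbitrary: p q)
  case (Suc i)
  have split: "x mod b ^ Suc i = (x div b mod b ^ i) * b + x mod b" for x
    by (simp add: mod_mult2_eq)
  have "digit_reversal b (Suc i) p = digit_reversal b (Suc i) q \<longleftrightarrow>
      p mod b = q mod b \<and> p div b mod b ^ i = q div b mod b ^ i"
    using mult_add_eq_iff[OF digit_reversal_less[OF assms] digit_reversal_less[OF assms]] Suc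
    by simp
  also have "\<dots> \<longleftrightarrow> p mod b ^ Suc i = q mod b ^ Suc i"
    unfolding split using assms by (subst mult_add_eq_iff) auto
  finally show ?case .
qed simp

text \<open>
  Together with \<open>digit_reversal_eq_iff\<close>, this turns the condition that \<open>p\<close> has prescribed lowest
  \<open>i\<close> digits into the condition that its reversal lies in one interval of length \<open>b ^ (k - i)\<close>.
\<close>

lemma digit_reversal_div:
  assumes "b > 0" "i \<le> k"
  shows "digit_reversal b k p div b ^ (k - i) = digit_reversal b i p"
  using digit_reversal_add[of b i "k - i" p] digit_reversal_less[OF assms(1), of "k - i" "p div b ^ i"]
    assms by simp

section \<open>Points and boxes in the integer grid\<close>

text \<open>A box is given by its lower corner and its upper corner, in this order.\<close>

definition in_open_box :: "nat \<times> nat \<Rightarrow> (nat \<times> nat) \<times> (nat \<times> nat) \<Rightarrow> bool" where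
  "in_open_box x B \<longleftrightarrow>
    fst (fst B) < fst x \<and> fst x < fst (snd B) \<and> snd (fst B) < snd x \<and> snd x < snd (snd B)"

text \<open>
  The coordinates are shifted by one so that the half-open intervals \<open>{D * M..<Suc D * M}\<close> that
  occur for quotients become open intervals with natural end points, including the case \<open>D = 0\<close>.
\<close>

definition digit_point :: "nat \<Rightarrow> nat \<Rightarrow> nat \<Rightarrow> nat \<times> nat" where
  "digit_point b k p = (Suc p, Suc (digit_reversal b k p))"

text \<open>
  The box around the line in direction \<open>i\<close> whose digits above position \<open>i\<close> are those of \<open>h\<close> and
  whose digits below position \<open>i\<close> are those of \<open>l\<close>.
\<close>

definition line_box :: "nat \<Rightarrow> nat \<Rightarrow> nat \<Rightarrow> nat \<Rightarrow> nat \<Rightarrow> (nat \<times> nat) \<times> (nat \<times> nat)" where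
  "line_box b k i h l =
    ((h * b ^ Suc i, digit_reversal b i l * b ^ (k - i)),
     (Suc (Suc h * b ^ Suc i), Suc (Suc (digit_reversal b i l) * b ^ (k - i))))"

definition digit_points :: "nat \<Rightarrow> nat \<Rightarrow> (nat \<times> nat) set" where
  "digit_points b k = digit_point b k ` {..<b ^ k}"

text \<open>
  The lines in direction \<open>i\<close> are indexed by the words \<open>m\<close> of length \<open>k - 1\<close> that remain when digit
  \<open>i\<close> is deleted, which makes their number evident.
\<close>

definition line_boxes :: "nat \<Rightarrow> nat \<Rightarrow> ((nat \<times> nat) \<times> (nat \<times> nat)) set" where
  "line_boxes b k =
    (\<lambda>(i, m). line_box b k i (m div b ^ i) (m mod b ^ i)) ` ({..<k} \<times> {..<b ^ (k - 1)})"

lemma inj_digit_point: "inj (digit_point b k)"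
  by (auto simp: inj_on_def digit_point_def)

lemma div_eq_iff_open_interval:
  fixes x M D :: nat
  assumes "M > 0"
  shows "x div M = D \<longleftrightarrow> D * M < Suc x \<and> Suc x < Suc (Suc D * M)"
proof
  assume "x div M = D"
  then show "D * M < Suc x \<and> Suc x < Suc (Suc D * M)"
    using assms div_times_less_eq_dividend[of x M] dividend_less_div_times[of M x]
    by (auto simp: algebra_simps)
next
  assume "D * M < Suc x \<and> Suc x < Suc (Suc D * M)"
  then show "x div M = D" by (intro div_nat_eqI) (auto simp: algebra_simps)
qed

text \<open>
  The first coordinate tests the digits above position \<open>i\<close> and the second coordinate those below it.
\<close>

lemma digit_point_in_line_box_iff:
  assumes "b > 0" "i \<le> k" "l < b ^ i"
  shows "in_open_box (digit_point b k p) (line_box b k i h l) \<longleftrightarrow>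
    p div b ^ Suc i = h \<and> p mod b ^ i = l"
proof -
  have "p mod b ^ i = l \<longleftrightarrow> digit_reversal b i p = digit_reversal b i l"
    using digit_reversal_eq_iff[OF assms(1)] assms(3) by simp
  also have "\<dots> \<longleftrightarrow> digit_reversal b k p div b ^ (k - i) = digit_reversal b i l"
    using digit_reversal_div assms by simp
  finally show ?thesis
    using div_eq_iff_open_interval[of "b ^ Suc i" p h]
      div_eq_iff_open_interval[of "b ^ (k - i)" "digit_reversal b k p" "digit_reversal b i l"] assms(1)
    by (auto simp: in_open_box_def digit_point_def line_box_def)
qed

lemma line_boxE:
  assumes "b > 0" "B \<in> line_boxes b k"
  obtains i h l where "i < k" "l < b ^ i" "B = line_box b k i h l"
proof -
  obtain i m where "i < k" "B = line_box b k i (m div b ^ i) (m mod b ^ i)"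
    using assms(2) by (auto simp: line_boxes_def)
  then show ?thesis using assms(1) by (intro that[of i "m mod b ^ i" "m div b ^ i"]) simp_all
qed

lemma line_box_in_line_boxes:
  assumes "b > 0" "i < k" "p < b ^ k"
  shows "line_box b k i (p div b ^ Suc i) (p mod b ^ i) \<in> line_boxes b k"
proof -
  define h l where "h = p div b ^ Suc i" and "l = p mod b ^ i"
  \<comment> \<open>The word \<open>p\<close> with digit \<open>i\<close> deleted.\<close>
  define m where "m = h * b ^ i + l"
  have l: "l < b ^ i" using assms(1) by (simp add: l_def)
  have "b ^ k = b ^ (k - 1 - i) * b ^ Suc i"
    using assms(2) by (simp flip: power_add power_Suc)
  with assms(3) have "h < b ^ (k - 1 - i)"
    unfolding h_def by (intro less_mult_imp_div_less) simp
  then have "Suc h * b ^ i \<le> b ^ (k - 1 - i) * b ^ i" by (intro mult_right_mono) auto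
  also have "\<dots> = b ^ (k - 1)" using assms(2) by (simp flip: power_add)
  finally have m_less: "m < b ^ (k - 1)" using l by (simp add: m_def)
  have "m div b ^ i = h" "m mod b ^ i = l" using l assms(1) by (simp_all add: m_def div_add1_eq)
  then show ?thesis
    using m_less assms(2) unfolding line_boxes_def h_def l_def
    by (intro image_eqI[where x = "(i, m)"]) auto
qed

lemma finite_line_boxes: "finite (line_boxes b k)"
  by (simp add: line_boxes_def)

lemma card_line_boxes_le: "card (line_boxes b k) \<le> k * b ^ (k - 1)"
  using card_image_le[of "{..<k} \<times> {..<b ^ (k - 1)}"
      "\<lambda>(i, m). line_box b k i (m div b ^ i) (m mod b ^ i)"]
  by (simp add: line_boxes_def)

lemma finite_digit_points: "finite (digit_points b k)"
  by (simp add: digit_points_def)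

lemma card_digit_points: "card (digit_points b k) = b ^ k"
  using inj_digit_point by (simp add: digit_points_def card_image inj_on_def)

lemma line_boxes_nonempty_sides:
  assumes "b > 0" "B \<in> line_boxes b k"
  shows "fst (fst B) < fst (snd B) \<and> snd (fst B) < snd (snd B)"
proof -
  obtain i h l where B: "B = line_box b k i h l" using line_boxE[OF assms] by metis
  have "x * y < Suc (Suc x * y)" for x y :: nat by simp
  then show ?thesis by (simp add: B line_box_def del: mult_Suc power_Suc)
qed

text \<open>
  The digits above position \<open>i\<close> and those below position \<open>i'\<close> together are all digits when \<open>i < i'\<close>.
  Hence two distinct words cannot share lines in two different directions.
\<close>

lemma eq_of_digits_agree:
  fixes p p' :: nat
  assumes "i < i'" "p div b ^ Suc i = p' div b ^ Suc i" "p mod b ^ i' = p' mod b ^ i'"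
  shows "p = p'"
proof -
  have "b ^ Suc i dvd b ^ i'" using assms(1) by (intro le_imp_power_dvd) simp
  then have "p mod b ^ Suc i = p' mod b ^ Suc i"
    using assms(3) by (metis mod_mod_cancel)
  with assms(2) show ?thesis by (metis div_mult_mod_eq)
qed

lemma K22_free_digit_incidence:
  assumes "b > 0"
  shows "K22_free (bipartite_edges (digit_points b k) (line_boxes b k) in_open_box)"
  unfolding K22_free_def
proof (rule notI, elim exE conjE)
  fix x x' B B'
  let ?E = "bipartite_edges (digit_points b k) (line_boxes b k) in_open_box"
  assume x: "x \<noteq> x'" and B: "B \<noteq> B'"
    and E: "(x, B) \<in> ?E" "(x, B') \<in> ?E" "(x', B) \<in> ?E" "(x', B') \<in> ?E"
  obtain p p' where p: "x = digit_point b k p" "x' = digit_point b k p'"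
    using E by (auto simp: bipartite_edges_def digit_points_def)
  from E obtain "B \<in> line_boxes b k" "B' \<in> line_boxes b k" by (auto simp: bipartite_edges_def)
  then obtain i h l i' h' l' where
    i: "i < k" "l < b ^ i" "B = line_box b k i h l" and
    i': "i' < k" "l' < b ^ i'" "B' = line_box b k i' h' l'"
    using line_boxE[OF assms] by metis
  have on: "p div b ^ Suc i = h" "p mod b ^ i = l" "p' div b ^ Suc i = h" "p' mod b ^ i = l"
    "p div b ^ Suc i' = h'" "p mod b ^ i' = l'" "p' div b ^ Suc i' = h'" "p' mod b ^ i' = l'"
    using E digit_point_in_line_box_iff[OF assms] i i'
    by (simp_all add: bipartite_edges_def p del: power_Suc)
  have "p \<noteq> p'" using x p by auto
  moreover have "i \<noteq> i'" using B on i i' by auto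
  ultimately show False
    using on eq_of_digits_agree[of i i' p b p'] eq_of_digits_agree[of i' i p b p']
    by (metis linorder_neqE_nat)
qed

text \<open>
  Each word lies on one line in each of the \<open>k\<close> directions. For \<open>b = 1\<close> the
  boxes of different directions could coincide; for \<open>b \<ge> 2\<close> the width of a box reveals its direction.
\<close>

lemma card_digit_incidence_ge:
  assumes "b \<ge> 2"
  shows "card (bipartite_edges (digit_points b k) (line_boxes b k) in_open_box) \<ge> k * b ^ k"
proof -
  let ?E = "bipartite_edges (digit_points b k) (line_boxes b k) in_open_box"
  define f where "f = (\<lambda>(p, i). (digit_point b k p, line_box b k i (p div b ^ Suc i) (p mod b ^ i)))"
  have "inj f"
  proof (rule injI)
    fix z z' assume eq: "f z = f z'"
    obtain p i p' i' where z: "z = (p, i)" "z' = (p', i')" by (metis surj_pair)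
    have p: "p' = p" using eq by (auto simp: f_def z digit_point_def)
    have box: "line_box b k i (p div b ^ Suc i) (p mod b ^ i) =
        line_box b k i' (p div b ^ Suc i') (p mod b ^ i')"
      using eq by (simp add: f_def z p del: power_Suc)
    \<comment> \<open>The two boxes have equal left ends \<open>h * b ^ Suc i\<close> and equal right ends, hence equal widths.\<close>
    have "b ^ Suc i = b ^ Suc i'"
      using box by (simp add: line_box_def del: power_Suc)
    with assms show "z = z'" by (simp add: z p power_inject_exp del: power_Suc)
  qed
  moreover have "f ` ({..<b ^ k} \<times> {..<k}) \<subseteq> ?E"
    using assms line_box_in_line_boxes[of b _ k] digit_point_in_line_box_iff[of b]
    by (auto simp: f_def bipartite_edges_def digit_points_def simp del: power_Suc)
  moreover have "finite ?E"
    by (rule finite_subset[of _ "digit_points b k \<times> line_boxes b k"])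
      (auto simp: bipartite_edges_def finite_digit_points finite_line_boxes)
  ultimately have "card ({..<b ^ k} \<times> {..<k}) \<le> card ?E"
    by (metis card_inj_on_le inj_on_subset subset_UNIV)
  then show ?thesis by (simp add: mult.commute)
qed

section \<open>Realisation over a valued field\<close>

lemma K22_free_image:
  assumes "inj f" "inj g" "K22_free E"
  shows "K22_free (map_prod f g ` E)"
  unfolding K22_free_def
proof (rule notI, elim exE conjE)
  fix p p' q q'
  assume ne: "p \<noteq> p'" "q \<noteq> q'" and
    im: "(p, q) \<in> map_prod f g ` E" "(p, q') \<in> map_prod f g ` E"
    "(p', q) \<in> map_prod f g ` E" "(p', q') \<in> map_prod f g ` E"
  from im(1) obtain a c where a: "p = f a" "q = g c" by auto
  from im(4) obtain a' c' where a': "p' = f a'" "q' = g c'" by auto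
  have "(a, c) \<in> E" "(a, c') \<in> E" "(a', c) \<in> E" "(a', c') \<in> E"
    using im assms(1,2) by (auto simp: a a' inj_eq)
  with ne assms(3) show False unfolding a a' K22_free_def by metis
qed

context valued_field
begin

lemma v_one: "v 1 = 0"
proof -
  obtain g where g: "v 1 = Fin g"
    using v_not_Minf[of 1] v_eq_Pinf_iff[of 1] by (cases "v 1") auto
  have "Fin g = Fin (g + g)" using v_mult[of 1 1] g by simp
  with g show ?thesis by (simp add: zero_extended_def)
qed

lemma finite_value: "x \<noteq> 0 \<Longrightarrow> \<exists>g. v x = Fin g"
  using v_not_Minf[of x] v_eq_Pinf_iff[of x] by (cases "v x") auto

lemma positive_value_exists:
  assumes "infinite (value_group v)"
  obtains t where "t \<noteq> 0" "v t > 0"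
proof -
  have "\<not> value_group v \<subseteq> {0}" using assms finite_subset by blast
  then obtain x where x: "x \<noteq> 0" "v x \<noteq> 0" by (auto simp: value_group_def)
  obtain g g' where g: "v x = Fin g" "v (inverse x) = Fin g'"
    using finite_value x(1) by (metis inverse_zero_imp_zero)
  have "Fin (g + g') = 0" using v_mult[of x "inverse x"] g x v_one by simp
  then have "g' = - g" by (simp add: zero_extended_def eq_neg_iff_add_eq_0 add.commute)
  show ?thesis
  proof (cases "g > 0")
    case True
    with g x show ?thesis by (intro that[of x]) (auto simp: zero_extended_def)
  next
    case False
    then have "g' > 0" using x g \<open>g' = - g\<close> by (auto simp: zero_extended_def)
    with g x show ?thesis by (intro that[of "inverse x"]) (auto simp: zero_extended_def)
  qed
qed

lemma strict_mono_v_power: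
  assumes "t \<noteq> 0" "v t > 0"
  shows "strict_mono (\<lambda>n. v (t ^ n))"
  unfolding strict_mono_Suc_iff
proof
  fix n
  obtain g h where "v t = Fin g" "v (t ^ n) = Fin h"
    using finite_value assms(1) by (metis power_not_zero)
  then show "v (t ^ n) < v (t ^ Suc n)"
    using v_mult[of t "t ^ n"] assms(2) by (simp add: zero_extended_def)
qed

end

definition monomial_point :: "'k::field \<Rightarrow> nat \<times> nat \<Rightarrow> 'k^2" where
  "monomial_point t a = vector [t ^ fst a, t ^ snd a]"

lemma monomial_point_nth [simp]:
  "monomial_point t a $ 1 = t ^ fst a" "monomial_point t a $ 2 = t ^ snd a"
  by (simp_all add: monomial_point_def)

text \<open>
  Since \<open>n \<mapsto> v (t ^ n)\<close> preserves and reflects strict order, every finite configuration of points and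
  open boxes in the natural grid is copied into \<open>K\<^sup>2\<close> with the same incidences. The condition on the
  sides of the boxes is what makes the copies legitimate parameters.
\<close>

lemma (in valued_field) grid_incidence_realisation:
  fixes S :: "(nat \<times> nat) set" and B :: "((nat \<times> nat) \<times> (nat \<times> nat)) set"
  assumes "infinite (value_group v)" "finite S" "finite B"
    and sides: "\<And>q. q \<in> B \<Longrightarrow> fst (fst q) < fst (snd q) \<and> snd (fst q) < snd (snd q)"
    and free: "K22_free (bipartite_edges S B in_open_box)"
  obtains P :: "('k^2) set" and Q :: "(('k^2) \<times> ('k^2)) set"
  where "finite P" "finite Q" "Q \<subseteq> box_parameters v" "card P = card S" "card Q = card B"
    "K22_free (bipartite_edges P Q (\<lambda>x (u, w). box_incidence v x u w))"
    "card (bipartite_edges P Q (\<lambda>x (u, w). box_incidence v x u w)) =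
      card (bipartite_edges S B in_open_box)"
proof -
  obtain t where t: "t \<noteq> 0" "v t > 0" using positive_value_exists assms(1) by blast
  note less_iff = strict_mono_less[OF strict_mono_v_power[OF t]]
  have inj_pow: "t ^ m = t ^ n \<longleftrightarrow> m = n" for m n
    using less_iff[of m n] less_iff[of n m] by (metis less_irrefl linorder_neqE_nat)
  let ?f = "monomial_point t" and ?g = "map_prod (monomial_point t) (monomial_point t)"
  let ?R = "\<lambda>x (u, w). box_incidence v x u w"
  have inj_f: "inj ?f"
  proof (rule injI)
    fix a c assume "?f a = ?f c"
    then have "?f a $ 1 = ?f c $ 1" "?f a $ 2 = ?f c $ 2" by simp_all
    then show "a = c" by (simp add: inj_pow prod_eq_iff)
  qed
  have inj_g: "inj ?g" using inj_f inj_f by (rule prod.inj_map)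
  have incidence: "?R (?f a) (?g q) \<longleftrightarrow> in_open_box a q" for a q
    by (cases q) (auto simp: box_incidence_def forall_2 less_iff in_open_box_def)
  have edges: "bipartite_edges (?f ` S) (?g ` B) ?R =
      map_prod ?f ?g ` bipartite_edges S B in_open_box"
    using incidence by (force simp: bipartite_edges_def)
  show ?thesis
  proof (rule that[of "?f ` S" "?g ` B"])
    show "finite (?f ` S)" "finite (?g ` B)" using assms by simp_all
    show "card (?f ` S) = card S" by (rule card_image[OF inj_on_subset[OF inj_f]]) simp
    show "card (?g ` B) = card B" by (rule card_image[OF inj_on_subset[OF inj_g]]) simp
    show "?g ` B \<subseteq> box_parameters v"
      using sides t(1) by (fastforce simp: box_parameters_def forall_2 less_iff)
    show "K22_free (bipartite_edges (?f ` S) (?g ` B) ?R)"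
      unfolding edges by (rule K22_free_image[OF inj_f inj_g free])
    show "card (bipartite_edges (?f ` S) (?g ` B) ?R) = card (bipartite_edges S B in_open_box)"
      unfolding edges
      by (rule card_image[OF inj_on_subset[OF prod.inj_map[OF inj_f inj_g]]]) simp
  qed
qed

section \<open>The size of the construction\<close>

text \<open>
  From \<open>ln n \<le> ln 2 + k * ln k \<le> 2 * k * ln k\<close> and \<open>ln (ln n) \<ge> ln (k * ln k) \<ge> ln k\<close> the quotient is
  at most \<open>2 * k\<close>. The bound \<open>k \<ge> 3 > exp 1\<close> ensures \<open>ln k \<ge> 1\<close>, which the second estimate uses.
\<close>

lemma log_ratio_le:
  fixes k n :: nat
  assumes "k \<ge> 3" "k ^ k \<le> n" "n \<le> 2 * k ^ k"
  shows "real n * (ln (real n) / ln (ln (real n))) \<le> 4 * (real k * real k ^ k)"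
proof -
  have "exp 1 \<le> real k" using exp_le assms(1) by linarith
  then have ln_k: "ln (real k) \<ge> 1" using assms(1) by (simp add: ln_ge_iff)
  have pos: "real k ^ k > 0" using assms(1) by simp
  have lower: "real k ^ k \<le> real n" and upper: "real n \<le> 2 * real k ^ k"
    using assms(2,3) by (simp_all flip: of_nat_power of_nat_mult add: of_nat_le_iff)
  have pos_n: "real n > 0" using lower pos by linarith
  have "ln (real n) \<le> ln (2 * real k ^ k)"
    using upper pos pos_n by (subst ln_le_cancel_iff) auto
  also have "\<dots> = ln 2 + real k * ln (real k)"
    using assms(1) by (simp add: ln_mult ln_realpow)
  also have "\<dots> \<le> ln (real k) + real k * ln (real k)" using assms(1) by simp
  also have "\<dots> \<le> 2 * real k * ln (real k)"
    using assms(1) ln_k by (simp add: algebra_simps)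
  finally have num: "ln (real n) \<le> 2 * real k * ln (real k)" .
  have "real k \<le> real k * ln (real k)" using ln_k assms(1) by simp
  also have "\<dots> = ln (real k ^ k)" using assms(1) by (simp add: ln_realpow)
  also have "\<dots> \<le> ln (real n)"
    using lower pos pos_n by (subst ln_le_cancel_iff) auto
  finally have ge_k: "real k \<le> ln (real n)" .
  then have den: "ln (real k) \<le> ln (ln (real n))" using assms(1) by simp
  have "ln (real n) / ln (ln (real n)) \<le> (2 * real k * ln (real k)) / ln (real k)"
    using num den ln_k ge_k assms(1) by (intro frac_le) auto
  also have "\<dots> = 2 * real k" using ln_k by simp
  finally have "real n * (ln (real n) / ln (ln (real n))) \<le> real n * (2 * real k)"
    by (intro mult_left_mono) auto
  also have "\<dots> \<le> (2 * real k ^ k) * (2 * real k)" using upper by (intro mult_right_mono) auto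
  finally show ?thesis by (simp add: algebra_simps)
qed

section \<open>Description complexity of the incidence relation\<close>

lemma affine_function_coordinate: "affine_function (\<lambda>x :: 'k::field^'d. x $ i)"
proof -
  have "Vector_Spaces.linear (*s) (*) (\<lambda>x :: 'k^'d. x $ i)"
    by unfold_locales (auto simp: algebra_simps)
  then show ?thesis unfolding affine_function_def by force
qed

lemma semilinear_box_incidence:
  fixes v :: "'k::field \<Rightarrow> 'g::linordered_ab_group_add extended"
  shows "semilinear v 1 (2 * CARD('d))
    {vec_append x (vec_append u w) | (x :: 'k^'d) (u :: 'k^'d) (w :: 'k^'d). box_incidence v x u w}"
proof -
  define L where "L = (\<lambda>j::'d. {z :: 'k^('d + 'd + 'd). v (z $ Inr (Inl j)) < v (z $ Inl j)})"
  define U where "U = (\<lambda>j::'d. {z :: 'k^('d + 'd + 'd). v (z $ Inl j) < v (z $ Inr (Inr j))})"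
  let ?C = "range L \<union> range U"
  have "valuative_condition v C" if "C \<in> ?C" for C
    using that affine_function_coordinate
    unfolding valuative_condition_def L_def U_def by blast
  moreover have "card ?C \<le> 2 * CARD('d)"
    using card_Un_le[of "range L" "range U"] card_image_le[of UNIV L] card_image_le[of UNIV U]
    by simp
  moreover have "{vec_append x (vec_append u w) | x u w. box_incidence v x u w} = \<Inter>?C"
  proof (intro equalityI subsetI)
    fix z :: "'k^('d + 'd + 'd)" assume z: "z \<in> \<Inter>?C"
    define x u w where "x = (\<chi> j. z $ Inl j)" and "u = (\<chi> j. z $ Inr (Inl j))"
      and "w = (\<chi> j. z $ Inr (Inr j))"
    have "z = vec_append x (vec_append u w)"
      by (auto simp: vec_eq_iff vec_append_def x_def u_def w_def split: sum.split)
    moreover have "box_incidence v x u w"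
      using z by (auto simp: box_incidence_def L_def U_def x_def u_def w_def)
    ultimately show "z \<in> {vec_append x (vec_append u w) | x u w. box_incidence v x u w}" by blast
  qed (auto simp: box_incidence_def L_def U_def vec_append_def)
  ultimately have "valuative_conjunction v (2 * CARD('d))
      {vec_append x (vec_append u w) | (x :: 'k^'d) (u :: 'k^'d) (w :: 'k^'d). box_incidence v x u w}"
    unfolding valuative_conjunction_def by (intro exI[of _ ?C]) auto
  then show ?thesis
    unfolding semilinear_def
    by (intro exI[of _ "{{vec_append x (vec_append u w) | (x :: 'k^'d) (u :: 'k^'d) (w :: 'k^'d).
      box_incidence v x u w}}"]) simp
qed

theorem theorem7p6:
  fixes v :: "'k::field \<Rightarrow> 'g::linordered_ab_group_add extended"
  assumes "valued_field v"
    and "infinite (value_group v)"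
  shows "(\<exists>c::real. c > 0 \<and> (\<forall>N::nat. \<exists>n\<ge>N. \<exists>(P :: ('k^2) set) (Q :: (('k^2) \<times> ('k^2)) set).
            finite P \<and> finite Q \<and> Q \<subseteq> box_parameters v \<and> card P + card Q = n \<and>
            (let E = bipartite_edges P Q (\<lambda>x (u, w). box_incidence v x u w)
             in K22_free E \<and> real (card E) \<ge> c * (real n * (ln (real n) / ln (ln (real n)))))))
         \<and> semilinear v 1 4
             {vec_append x (vec_append u w) | (x :: 'k^2) (u :: 'k^2) (w :: 'k^2).
                box_incidence v x u w}"
proof (intro conjI exI[of _ "1/4 :: real"] allI)
  fix N :: nat
  \<comment> \<open>Words of length \<open>k\<close> over an alphabet of size \<open>k\<close>: then there are at most as many lines as points.\<close>
  define k where "k = N + 3"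
  have k: "k \<ge> 3" "k > 0" by (simp_all add: k_def)
  let ?S = "digit_points k k" and ?B = "line_boxes k k"
  obtain P :: "('k^2) set" and Q :: "(('k^2) \<times> ('k^2)) set" where
    fin: "finite P" "finite Q" "Q \<subseteq> box_parameters v" and
    card: "card P = card ?S" "card Q = card ?B" and
    free: "K22_free (bipartite_edges P Q (\<lambda>x (u, w). box_incidence v x u w))" and
    edges: "card (bipartite_edges P Q (\<lambda>x (u, w). box_incidence v x u w)) =
      card (bipartite_edges ?S ?B in_open_box)"
    by (rule valued_field.grid_incidence_realisation[OF assms finite_digit_points[of k k]
      finite_line_boxes[of k k] line_boxes_nonempty_sides[OF k(2)] K22_free_digit_incidence[OF k(2)]])
  define n where "n = card P + card Q"
  have "card ?B \<le> k ^ k"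
    using card_line_boxes_le[of k k] power_minus_mult[OF k(2), of k] by (simp add: mult.commute)
  then have n: "k ^ k \<le> n" "n \<le> 2 * k ^ k" by (simp_all add: n_def card card_digit_points)
  have "N \<le> k" by (simp add: k_def)
  also have "k \<le> k ^ k" using k by (intro self_le_power) auto
  also note n(1)
  finally have "N \<le> n" .
  have quarter: "x \<le> 4 * y \<Longrightarrow> y \<le> z \<Longrightarrow> 1/4 * x \<le> z" for x y z :: real by simp
  have "real n * (ln (real n) / ln (ln (real n))) \<le> 4 * real (k * k ^ k)"
    using log_ratio_le[OF k(1) n] by simp
  moreover have "real (k * k ^ k) \<le> real (card (bipartite_edges ?S ?B in_open_box))"
    using card_digit_incidence_ge[of k k] k(1) by (intro of_nat_mono) simp
  ultimately have many: "real (card (bipartite_edges P Q (\<lambda>x (u, w). box_incidence v x u w))) \<ge>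
      1/4 * (real n * (ln (real n) / ln (ln (real n))))"
    unfolding edges by (rule quarter)
  show "\<exists>n\<ge>N. \<exists>(P :: ('k^2) set) (Q :: (('k^2) \<times> ('k^2)) set).
      finite P \<and> finite Q \<and> Q \<subseteq> box_parameters v \<and> card P + card Q = n \<and>
      (let E = bipartite_edges P Q (\<lambda>x (u, w). box_incidence v x u w)
       in K22_free E \<and> real (card E) \<ge> 1/4 * (real n * (ln (real n) / ln (ln (real n)))))"
    unfolding Let_def
    by (intro exI[of _ n] exI[of _ P] exI[of _ Q] conjI)
      (fact \<open>N \<le> n\<close> fin free many n_def[symmetric])+
next
  show "semilinear v 1 4
      {vec_append x (vec_append u w) | (x :: 'k^2) (u :: 'k^2) (w :: 'k^2). box_incidence v x u w}"
    using semilinear_box_incidence[where 'd = 2, of v] by simp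
qed simp

end
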